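(* Let $(E_t)_{t\in[T]}$ be a sequence of independent e-variables and $M_t=\prod_{s=1}^tE_s$. Let $\tau$ be a predictable stopping time and assume that $E_t\in\mathcal E$ for $t\in[T]$, where $\mathcal E$ is a set of e-variables. Let $\gamma\in(0,1]$. (i) Let $r(x)=R_x(\mathcal E)$ for $x>0$. Then $r(x)\le x$ for $x>0$ and $$\mathbb P(M_\tau\ge 1/\gamma)\le\mathbb E[r(\gamma M_{\tau-1})]\le\gamma.$$ (ii) Suppose there exist constants $\zeta,\theta\in(0,1]$ such that $R_x(\mathcal E)\le\zeta x$ for $x\in[0,\theta)$, and let $\delta=\mathbb P(\theta\le\gamma M_{\tau-1}<1/\zeta)$. Then $$\mathbb P(M_\tau\ge1/\gamma)\le\zeta\gamma+(1/\zeta-1)\delta.$$ (iii) If $\mathcal E$ is the class of e-variables with decreasing densities on $(0,\infty)$, then $$\mathbb P(M_\tau\ge1/\gamma)\le\frac{\gamma}{2}.$$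
   Context: Fix a sample space with a probability measure $\mathbb P$ and expectation $\mathbb E$. Here $[T]=\{1,\dots,T\}$, where $T$ is finite or infinite (with $[T]=\mathbb N$ when $T=\infty$), and $(\mathcal F_t)_{t\in\{0,1,\dots,T\}}$ is a given filtration to which $(E_t)_{t\in[T]}$ is adapted. An e-variable is a $[0,\infty]$-valued random variable $E$ with $\mathbb E[E]\le 1$. For a set $\mathcal E$ of e-variables, $R_\gamma(\mathcal E)=\sup_{E\in\mathcal E}\mathbb P(E\ge1/\gamma)$ for $\gamma>0$, and, with $1/0=\infty$, $R_0(\mathcal E)=r(0)=0$. The empty product is $M_0=1$. A stopping time $\tau$ is called predictable if $\{\tau=t\}\in\mathcal F_{t-1}$ for every $t\in[T]$ and it takes values in $[T]$. "Decreasing" is in the non-strict sense; a random variable with a decreasing density is allowed to have a point mass at the left endpoint of its support.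
   Formalization: Each E_t is additionally assumed independent of F_{t-1} (automatic for the natural filtration); for a larger filtration to which the sequence is merely adapted, F_0 could reveal the future and the bounds fail. *)

theory Defs
  imports "HOL-Probability.Probability" "HOL-Library.Extended_Nat"
begin

definition time_set :: "enat \<Rightarrow> nat set" where
  "time_set T = {t. 1 \<le> t \<and> enat t \<le> T}"

definition e_variable :: "'a measure \<Rightarrow> ('a \<Rightarrow> ennreal) \<Rightarrow> bool" where
  "e_variable M E \<longleftrightarrow> E \<in> borel_measurable M \<and> (\<integral>\<^sup>+\<omega>. E \<omega> \<partial>M) \<le> 1"

definition M_proc :: "(nat \<Rightarrow> 'a \<Rightarrow> ennreal) \<Rightarrow> nat \<Rightarrow> 'a \<Rightarrow> ennreal" where
  "M_proc E t \<omega> = (\<Prod>s=1..t. E s \<omega>)"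

(* The level x ranges over [0, \<infinity>], since it is evaluated at multiples of a
   [0, \<infinity>]-valued process; 1 / \<infinity> = 0 in ennreal. *)
definition R_sup :: "'a measure \<Rightarrow> ('a \<Rightarrow> ennreal) set \<Rightarrow> ennreal \<Rightarrow> ennreal" where
  "R_sup M \<E> x =
     (if x = 0 then 0 else (SUP E\<in>\<E>. emeasure M {\<omega> \<in> space M. 1 / x \<le> E \<omega>}))"

(* Only the sigma-algebras F t with t \<le> T are constrained. *)
definition filtration_upto :: "'a measure \<Rightarrow> enat \<Rightarrow> (nat \<Rightarrow> 'a measure) \<Rightarrow> bool" where
  "filtration_upto M T F \<longleftrightarrow>
     (\<forall>t. enat t \<le> T \<longrightarrow> subalgebra M (F t)) \<and>
     (\<forall>s t. s \<le> t \<longrightarrow> enat t \<le> T \<longrightarrow> subalgebra (F t) (F s))"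

definition adapted_upto ::
  "enat \<Rightarrow> (nat \<Rightarrow> 'a measure) \<Rightarrow> (nat \<Rightarrow> 'a \<Rightarrow> ennreal) \<Rightarrow> bool" where
  "adapted_upto T F E \<longleftrightarrow> (\<forall>t\<in>time_set T. E t \<in> borel_measurable (F t))"

definition predictable_time ::
  "'a measure \<Rightarrow> enat \<Rightarrow> (nat \<Rightarrow> 'a measure) \<Rightarrow> ('a \<Rightarrow> nat) \<Rightarrow> bool" where
  "predictable_time M T F \<tau> \<longleftrightarrow>
     (\<forall>\<omega>\<in>space M. \<tau> \<omega> \<in> time_set T) \<and>
     (\<forall>t\<in>time_set T. {\<omega> \<in> space M. \<tau> \<omega> = t} \<in> sets (F (t - 1)))"

(* The filtration may be larger than the natural one, so that independence of the
   sequence E must be accompanied by independence of E t from F (t - 1): otherwise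
   F 0 could reveal the whole sequence and a predictable time could look ahead.
   For the natural filtration this follows from independence of the sequence. *)
definition indep_of_past ::
  "'a measure \<Rightarrow> enat \<Rightarrow> (nat \<Rightarrow> 'a measure) \<Rightarrow> (nat \<Rightarrow> 'a \<Rightarrow> ennreal) \<Rightarrow> bool" where
  "indep_of_past M T F E \<longleftrightarrow>
     (\<forall>t\<in>time_set T. prob_space.indep_set M
        (sets (vimage_algebra (space M) (E t) borel)) (sets (F (t - 1))))"

(* On (0, \<infinity>] the law of E has the density f, which decreases on (0, \<infinity>); in particular
   there is no mass at \<infinity>. The mass at 0 is unrestricted, 0 being the left endpoint of
   the support of a law whose density decreases on all of (0, \<infinity>). *)
definition has_decreasing_density :: "'a measure \<Rightarrow> ('a \<Rightarrow> ennreal) \<Rightarrow> bool" where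
  "has_decreasing_density M E \<longleftrightarrow>
     (\<exists>f :: real \<Rightarrow> ennreal. f \<in> borel_measurable borel \<and>
        (\<forall>x y. 0 < x \<longrightarrow> x \<le> y \<longrightarrow> f y \<le> f x) \<and>
        (\<forall>A\<in>sets (borel :: ennreal measure). 0 \<notin> A \<longrightarrow>
           emeasure (distr M borel E) A =
           emeasure (density lborel f) {x. 0 < x \<and> ennreal x \<in> A}))"

definition decreasing_density_class :: "'a measure \<Rightarrow> ('a \<Rightarrow> ennreal) set" where
  "decreasing_density_class M = {E. e_variable M E \<and> has_decreasing_density M E}"

end

theory Submission
  imports Defs
begin

text \<open>
  Write \<open>Z\<close> for \<open>\<gamma>\<close> times the product of the factors before the last one.  Since \<open>\<tau>\<close> is
  predictable, the event \<open>\<tau> = t\<close> and the product up to \<open>t - 1\<close> are both known at time \<open>t - 1\<close>,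
  whereas the last factor \<open>E t\<close> is independent of them.  Conditionally on that past, the product
  reaches \<open>1 / \<gamma>\<close> only if a fresh e-variable reaches \<open>1 / Z\<close>, which has probability at most
  \<open>R_sup M \<E> Z\<close>.  Freezing the past in this way (\<open>nn_integral_indep_var\<close>) and summing over the
  values of \<open>\<tau>\<close> bounds the probability in question by the mean of \<open>R_sup M \<E> Z\<close>
  (\<open>emeasure_M_tau_ge_le\<close>).

  The other half is that \<open>Z\<close> has mean at most \<open>\<gamma>\<close> (\<open>mean_scaled_before_tau_le\<close>).  The products
  form a supermartingale and \<open>\<tau> - 1\<close> is a stopping time; \<open>stopped_mean_le_1\<close> carries out the
  optional stopping by bookkeeping with nonnegative integrals, and monotone limits take care of
  an unbounded \<open>\<tau>\<close>.

  Each bound now follows from a pointwise bound on \<open>R_sup M \<E> z\<close>, integrated at \<open>z = Z\<close>.  Markov's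
  inequality gives \<open>z\<close>, hence (i).  The extra hypothesis in (ii) gives \<open>\<zeta> * z\<close> up to an error
  supported on the window between \<open>\<theta>\<close> and \<open>1 / \<zeta>\<close> (\<open>R_sup_le_linear_plus_window\<close>).  For
  decreasing densities Markov's inequality improves by a factor of two at every level, including
  the levels above \<open>1\<close> (\<open>emeasure_tail_decreasing_density\<close>), so that in (iii) no window term
  appears.
\<close>

section \<open>Monotone functions and integrals along a random index\<close>

text \<open>The preimage of an open upper ray is an upper set, hence itself a closed or open upper ray.\<close>
lemma borel_measurable_mono_order:
  fixes f :: "'a :: {complete_linorder, linorder_topology}
    \<Rightarrow> 'b :: {linorder_topology, second_countable_topology}"
  assumes "mono f"
  shows "f \<in> borel_measurable borel"
proof (rule borel_measurableI_greater)
  fix y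
  define U where "U = {x. y < f x}"
  have up: "x' \<in> U" if "x \<in> U" "x \<le> x'" for x x'
    using that monoD[OF assms, of x x'] by (auto simp: U_def)
  have "{Inf U<..} \<subseteq> U"
  proof
    fix x assume "x \<in> {Inf U<..}"
    then obtain u where "u \<in> U" "u < x"
      by (auto simp: Inf_less_iff)
    then show "x \<in> U"
      by (intro up[of u x]) auto
  qed
  moreover have "U \<subseteq> {Inf U..}"
    by (auto intro: Inf_lower)
  ultimately have "U = {Inf U..} \<or> U = {Inf U<..}"
    using up[of "Inf U"] by (cases "Inf U \<in> U") (auto simp: set_eq_iff subset_iff le_less)
  then have "U \<in> sets borel"
    by (metis atLeast_borel greaterThan_borel)
  then show "{x \<in> space borel. y < f x} \<in> sets borel"
    by (simp add: U_def)
qed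

lemma indicator_at_index_sums:
  fixes g :: "nat \<Rightarrow> ennreal"
  assumes "\<omega> \<in> A"
  shows "(\<Sum>t. indicator {\<omega> \<in> A. \<tau> \<omega> = t} \<omega> * g t) = g (\<tau> \<omega>)"
  using assms suminf_finite[of "{\<tau> \<omega>}" "\<lambda>t. indicator {\<omega> \<in> A. \<tau> \<omega> = t} \<omega> * g t"]
  by (auto simp: indicator_def)

lemma measurable_at_random_index:
  fixes \<tau> :: "'a \<Rightarrow> nat" and g :: "nat \<Rightarrow> 'a \<Rightarrow> ennreal"
  assumes [measurable]:
    "\<And>t. (\<lambda>\<omega>. indicator {\<omega> \<in> space M. \<tau> \<omega> = t} \<omega> * g t \<omega>) \<in> borel_measurable M"
  shows "(\<lambda>\<omega>. g (\<tau> \<omega>) \<omega>) \<in> borel_measurable M"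
proof -
  have "(\<lambda>\<omega>. \<Sum>t. indicator {\<omega> \<in> space M. \<tau> \<omega> = t} \<omega> * g t \<omega>) \<in> borel_measurable M"
    by measurable
  also have "?this \<longleftrightarrow> ?thesis"
    by (intro measurable_cong indicator_at_index_sums)
  finally show ?thesis .
qed

lemma nn_integral_at_random_index:
  fixes \<tau> :: "'a \<Rightarrow> nat" and g :: "nat \<Rightarrow> 'a \<Rightarrow> ennreal"
  assumes [measurable]:
    "\<And>t. (\<lambda>\<omega>. indicator {\<omega> \<in> space M. \<tau> \<omega> = t} \<omega> * g t \<omega>) \<in> borel_measurable M"
  shows "(\<integral>\<^sup>+\<omega>. g (\<tau> \<omega>) \<omega> \<partial>M) =
    (\<Sum>t. \<integral>\<^sup>+\<omega>. indicator {\<omega> \<in> space M. \<tau> \<omega> = t} \<omega> * g t \<omega> \<partial>M)"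
proof -
  have "(\<integral>\<^sup>+\<omega>. g (\<tau> \<omega>) \<omega> \<partial>M) =
      (\<integral>\<^sup>+\<omega>. (\<Sum>t. indicator {\<omega> \<in> space M. \<tau> \<omega> = t} \<omega> * g t \<omega>) \<partial>M)"
    by (intro nn_integral_cong indicator_at_index_sums[symmetric])
  also have "\<dots> = (\<Sum>t. \<integral>\<^sup>+\<omega>. indicator {\<omega> \<in> space M. \<tau> \<omega> = t} \<omega> * g t \<omega> \<partial>M)"
    by (intro nn_integral_suminf) measurable
  finally show ?thesis .
qed

lemma emeasure_eq_nn_integral_indicator:
  assumes "X \<in> measurable M N" "A \<in> sets N"
  shows "emeasure M {\<omega> \<in> space M. X \<omega> \<in> A} = (\<integral>\<^sup>+\<omega>. indicator A (X \<omega>) \<partial>M)"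
proof -
  have "emeasure M {\<omega> \<in> space M. X \<omega> \<in> A}
      = (\<integral>\<^sup>+\<omega>. indicator {\<omega> \<in> space M. X \<omega> \<in> A} \<omega> \<partial>M)"
    using measurable_sets[OF assms]
    by (intro nn_integral_indicator[symmetric]) (simp add: vimage_def Int_def conj_commute)
  also have "\<dots> = (\<integral>\<^sup>+\<omega>. indicator A (X \<omega>) \<partial>M)"
    by (intro nn_integral_cong) (auto split: split_indicator)
  finally show ?thesis .
qed

text \<open>
  Independence says that the joint law is a product law, so by Tonelli the first variable
  may be frozen while the second one is integrated.
\<close>
lemma (in prob_space) nn_integral_indep_var:
  assumes indep: "indep_var S X N Y" and h[measurable]: "h \<in> borel_measurable (S \<Otimes>\<^sub>M N)"
  shows "(\<integral>\<^sup>+\<omega>. h (X \<omega>, Y \<omega>) \<partial>M) = (\<integral>\<^sup>+\<omega>. \<integral>\<^sup>+\<omega>'. h (X \<omega>, Y \<omega>') \<partial>M \<partial>M)"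
proof -
  have [measurable]: "random_variable S X" "random_variable N Y"
    and eq: "distr M S X \<Otimes>\<^sub>M distr M N Y = distr M (S \<Otimes>\<^sub>M N) (\<lambda>\<omega>. (X \<omega>, Y \<omega>))"
    using indep by (auto simp: indep_var_distribution_eq)
  interpret Y: prob_space "distr M N Y"
    by (rule prob_space_distr) measurable
  have "(\<integral>\<^sup>+\<omega>. h (X \<omega>, Y \<omega>) \<partial>M) = (\<integral>\<^sup>+p. h p \<partial>(distr M S X \<Otimes>\<^sub>M distr M N Y))"
    by (simp add: eq nn_integral_distr)
  also have "\<dots> = (\<integral>\<^sup>+x. \<integral>\<^sup>+y. h (x, y) \<partial>distr M N Y \<partial>distr M S X)"
    by (rule Y.nn_integral_fst[symmetric]) measurable
  also have "\<dots> = (\<integral>\<^sup>+x. \<integral>\<^sup>+\<omega>'. h (x, Y \<omega>') \<partial>M \<partial>distr M S X)"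
    by (intro nn_integral_cong nn_integral_distr) (auto simp: measurable_Pair1)
  also have "\<dots> = (\<integral>\<^sup>+\<omega>. \<integral>\<^sup>+\<omega>'. h (X \<omega>, Y \<omega>') \<partial>M \<partial>M)"
    by (intro nn_integral_distr) measurable
  finally show ?thesis .
qed

section \<open>Worst-case exceedance probabilities\<close>

text \<open>
  A higher level means a lower threshold.  The members have to be measurable because
  \<open>emeasure\<close> is zero, hence not monotone, outside the measurable sets.
\<close>
lemma R_sup_mono:
  assumes "\<E> \<subseteq> borel_measurable M"
  shows "mono (R_sup M \<E>)"
proof (rule monoI)
  fix x y :: ennreal assume xy: "x \<le> y"
  show "R_sup M \<E> x \<le> R_sup M \<E> y"
  proof (cases "x = 0")
    case True
    then show ?thesis by (simp add: R_sup_def)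
  next
    case False
    have "1 / y \<le> 1 / x"
    proof (cases "x = top")
      case True
      with xy show ?thesis by (simp add: top_unique)
    next
      case x: False
      have "1 = x / x"
        using False x by (simp add: less_top)
      also have "\<dots> \<le> y / x"
        using xy by (rule divide_right_mono_ennreal)
      finally have "1 \<le> y * (1 / x)"
        by (simp add: ennreal_times_divide)
      then show ?thesis
        using False xy by (intro divide_le_posI_ennreal) (auto simp: zero_less_iff_neq_zero)
    qed
    then have "emeasure M {\<omega> \<in> space M. 1 / x \<le> X \<omega>} \<le> emeasure M {\<omega> \<in> space M. 1 / y \<le> X \<omega>}"
      if "X \<in> \<E>" for X
      using assms that by (intro emeasure_mono) auto
    then show ?thesis
      using False xy by (auto simp: R_sup_def intro!: SUP_mono)
  qed
qed

lemma borel_measurable_R_sup: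
  "\<E> \<subseteq> borel_measurable M \<Longrightarrow> R_sup M \<E> \<in> borel_measurable borel"
  by (intro borel_measurable_mono_order R_sup_mono)

lemma R_sup_zero[simp]: "R_sup M \<E> 0 = 0"
  by (simp add: R_sup_def)

lemma (in prob_space) R_sup_le_1: "R_sup M \<E> x \<le> 1"
  by (auto simp: R_sup_def intro!: SUP_least emeasure_le_1)

lemma R_sup_le:
  assumes "\<forall>X\<in>\<E>. e_variable M X"
  shows "R_sup M \<E> x \<le> x"
proof (cases "x = 0 \<or> x = top")
  case False
  have "emeasure M {\<omega> \<in> space M. 1 / x \<le> X \<omega>} \<le> x" if "X \<in> \<E>" for X
  proof -
    have [measurable]: "X \<in> borel_measurable M" and le: "(\<integral>\<^sup>+\<omega>. X \<omega> \<partial>M) \<le> 1"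
      using assms that by (auto simp: e_variable_def)
    have "1 \<le> x * y" if "1 / x \<le> y" for y
      using mult_left_mono[OF that, of x] False by (simp add: ennreal_times_divide less_top)
    then have "emeasure M {\<omega> \<in> space M. 1 / x \<le> X \<omega>} \<le> emeasure M {\<omega> \<in> space M. 1 \<le> x * X \<omega>}"
      by (intro emeasure_mono) auto
    also have "\<dots> \<le> x * (\<integral>\<^sup>+\<omega>. X \<omega> * indicator (space M) \<omega> \<partial>M)"
      by (rule nn_integral_Markov_inequality) auto
    also have "(\<integral>\<^sup>+\<omega>. X \<omega> * indicator (space M) \<omega> \<partial>M) = (\<integral>\<^sup>+\<omega>. X \<omega> \<partial>M)"
      by (intro nn_integral_cong) auto
    also have "x * \<dots> \<le> x"
      using mult_left_mono[OF le, of x] by simp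
    finally show ?thesis .
  qed
  then show ?thesis
    using False by (auto simp: R_sup_def intro!: SUP_least)
qed auto

section \<open>Decreasing densities\<close>

text \<open>
  Both sides differ by the integral of \<open>f\<close> against \<open>x / (2 * a) - 1\<close> on \<open>{a..}\<close> and against
  \<open>x / (2 * a)\<close> below \<open>a\<close>.  The only negative part lies on \<open>{a..<2 * a}\<close>; reflecting it at \<open>a\<close>
  gives \<open>x / (2 * a)\<close> against \<open>f (2 * a - x)\<close>, and there \<open>f (2 * a - x) \<le> f x\<close>.
\<close>
lemma nn_integral_antimono_tail_le:
  fixes f :: "real \<Rightarrow> ennreal" and a :: real
  assumes [measurable]: "f \<in> borel_measurable borel"
    and decr: "\<And>x y. 0 < x \<Longrightarrow> x \<le> y \<Longrightarrow> f y \<le> f x" and a: "0 < a"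
  shows "(\<integral>\<^sup>+x. f x * indicator {a..} x \<partial>lborel)
    \<le> (\<integral>\<^sup>+x. ennreal (x / (2 * a)) * f x * indicator {0<..} x \<partial>lborel)"
proof -
  define deficit where "deficit x = ennreal (1 - x / (2 * a)) * f x * indicator {a..<2 * a} x" for x
  have [measurable]: "deficit \<in> borel_measurable borel"
    unfolding deficit_def by measurable
  have split: "f x * indicator {a..} x
      \<le> ennreal (x / (2 * a)) * f x * indicator {a..} x + deficit x" for x
  proof (cases "x < 2 * a")
    case True
    show ?thesis
    proof (cases "a \<le> x")
      case a_le: True
      have "ennreal (x / (2 * a)) + ennreal (1 - x / (2 * a)) = 1"
        using True a a_le by (subst ennreal_plus[symmetric]) auto
      then have "f x = ennreal (x / (2 * a)) * f x + ennreal (1 - x / (2 * a)) * f x"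
        by (metis distrib_right mult_1)
      then show ?thesis
        using True a_le by (simp add: deficit_def)
    qed simp
  next
    case False
    then have "1 \<le> ennreal (x / (2 * a))"
      using a by (simp add: field_simps)
    from mult_right_mono[OF this, of "f x"] show ?thesis
      using False a by (simp add: deficit_def)
  qed
  have reflect: "deficit (2 * a + (- 1) * x) \<le> ennreal (x / (2 * a)) * f x * indicator {0<..a} x" for x
  proof (cases "0 < x \<and> x \<le> a")
    case True
    then have "f (2 * a - x) \<le> f x" and "1 - (2 * a - x) / (2 * a) = x / (2 * a)"
      using a by (auto intro: decr simp: field_simps)
    then show ?thesis
      using True by (auto simp: deficit_def intro!: mult_left_mono)
  next
    case False
    then show ?thesis
      by (auto simp: deficit_def indicator_def)
  qed
  have "(\<integral>\<^sup>+x. f x * indicator {a..} x \<partial>lborel)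
      \<le> (\<integral>\<^sup>+x. ennreal (x / (2 * a)) * f x * indicator {a..} x + deficit x \<partial>lborel)"
    by (intro nn_integral_mono split)
  also have "\<dots> = (\<integral>\<^sup>+x. ennreal (x / (2 * a)) * f x * indicator {a..} x \<partial>lborel)
      + (\<integral>\<^sup>+x. deficit x \<partial>lborel)"
    by (intro nn_integral_add) measurable
  also have "(\<integral>\<^sup>+x. deficit x \<partial>lborel) = (\<integral>\<^sup>+x. deficit (2 * a + (- 1) * x) \<partial>lborel)"
    by (subst nn_integral_real_affine[where c = "- 1" and t = "2 * a"]) auto
  also have "\<dots> \<le> (\<integral>\<^sup>+x. ennreal (x / (2 * a)) * f x * indicator {0<..a} x \<partial>lborel)"
    by (intro nn_integral_mono reflect)
  also have "(\<integral>\<^sup>+x. ennreal (x / (2 * a)) * f x * indicator {a..} x \<partial>lborel) + \<dots>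
      = (\<integral>\<^sup>+x. ennreal (x / (2 * a)) * f x * indicator {a..} x
          + ennreal (x / (2 * a)) * f x * indicator {0<..a} x \<partial>lborel)"
    by (intro nn_integral_add[symmetric]) measurable
  also have "\<dots> = (\<integral>\<^sup>+x. ennreal (x / (2 * a)) * f x * indicator {0<..} x \<partial>lborel)"
  \<comment> \<open>The two ranges overlap in the single point \<open>a\<close>.\<close>
    using AE_lborel_singleton[of a] a
    by (intro nn_integral_cong_AE) (auto elim!: eventually_mono simp: indicator_def)
  finally show ?thesis
    by (simp add: add_left_mono)
qed

text \<open>
  The law of \<open>E\<close> is known only away from zero, so \<open>h\<close> has to vanish there.
\<close>
lemma nn_integral_via_density:
  assumes [measurable]: "E \<in> borel_measurable M" "f \<in> borel_measurable borel"
    and law: "\<And>A. A \<in> sets (borel :: ennreal measure) \<Longrightarrow> 0 \<notin> A \<Longrightarrow>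
      emeasure (distr M borel E) A = emeasure (density lborel f) {x. 0 < x \<and> ennreal x \<in> A}"
    and [measurable]: "h \<in> borel_measurable borel" and h0: "h 0 = 0"
  shows "(\<integral>\<^sup>+\<omega>. h (E \<omega>) \<partial>M) = (\<integral>\<^sup>+x. f x * h (ennreal x) * indicator {0<..} x \<partial>lborel)"
proof -
  let ?D = "density (distr M borel E) (indicator {0<..})"
  let ?N = "distr (density lborel (\<lambda>x. f x * indicator {0<..} x)) borel ennreal"
  have "?D = ?N"
  proof (rule measure_eqI)
    fix A :: "ennreal set" assume "A \<in> sets ?D"
    then have [measurable]: "A \<in> sets borel" by simp
    have [measurable]: "{x::real. 0 < x \<and> ennreal x \<in> A \<inter> {0<..}} \<in> sets borel"
      by measurable
    have "emeasure ?D A = (\<integral>\<^sup>+y. indicator {0<..} y * indicator A y \<partial>distr M borel E)"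
      by (rule emeasure_density) auto
    also have "\<dots> = (\<integral>\<^sup>+y. indicator (A \<inter> {0<..}) y \<partial>distr M borel E)"
      by (intro nn_integral_cong) (auto split: split_indicator)
    also have "\<dots> = emeasure (distr M borel E) (A \<inter> {0<..})"
      by (rule nn_integral_indicator) auto
    also have "\<dots> = emeasure (density lborel f) {x. 0 < x \<and> ennreal x \<in> A \<inter> {0<..}}"
      by (rule law) auto
    also have "\<dots> = (\<integral>\<^sup>+x. f x * indicator {x. 0 < x \<and> ennreal x \<in> A \<inter> {0<..}} x \<partial>lborel)"
      by (rule emeasure_density) auto
    also have "\<dots> = (\<integral>\<^sup>+x. f x * indicator {0<..} x * indicator (ennreal -` A) x \<partial>lborel)"
      by (intro nn_integral_cong) (auto simp: indicator_def)
    also have "\<dots> = emeasure ?N A"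
      using measurable_sets[of ennreal borel borel A]
      by (subst emeasure_distr, measurable, subst emeasure_density) auto
    finally show "emeasure ?D A = emeasure ?N A" .
  qed simp
  have "(\<integral>\<^sup>+\<omega>. h (E \<omega>) \<partial>M) = (\<integral>\<^sup>+y. indicator {0<..} y * h y \<partial>distr M borel E)"
    using h0 by (auto simp: nn_integral_distr intro!: nn_integral_cong split: split_indicator)
  also have "\<dots> = (\<integral>\<^sup>+y. h y \<partial>?D)"
    by (rule nn_integral_density[symmetric]) auto
  also have "\<dots> = (\<integral>\<^sup>+x. f x * h (ennreal x) * indicator {0<..} x \<partial>lborel)"
    unfolding \<open>?D = ?N\<close> by (simp add: nn_integral_distr nn_integral_density mult_ac)
  finally show ?thesis .
qed

text \<open>
  Markov's inequality gains the factor two because a decreasing density cannot concentrate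
  at the threshold; an atom at zero contributes to neither side.
\<close>
lemma emeasure_tail_decreasing_density:
  assumes [measurable]: "E \<in> borel_measurable M" and "has_decreasing_density M E" and a: "0 < a"
  shows "emeasure M {\<omega> \<in> space M. ennreal a \<le> E \<omega>} \<le> ennreal (1 / (2 * a)) * (\<integral>\<^sup>+\<omega>. E \<omega> \<partial>M)"
proof -
  obtain f :: "real \<Rightarrow> ennreal" where f[measurable]: "f \<in> borel_measurable borel"
    and decr: "\<And>x y. 0 < x \<Longrightarrow> x \<le> y \<Longrightarrow> f y \<le> f x"
    and law: "\<And>A. A \<in> sets (borel :: ennreal measure) \<Longrightarrow> 0 \<notin> A \<Longrightarrow>
      emeasure (distr M borel E) A = emeasure (density lborel f) {x. 0 < x \<and> ennreal x \<in> A}"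
    using assms(2) unfolding has_decreasing_density_def by blast
  have "emeasure M {\<omega> \<in> space M. ennreal a \<le> E \<omega>} = (\<integral>\<^sup>+\<omega>. indicator {ennreal a..} (E \<omega>) \<partial>M)"
    using emeasure_eq_nn_integral_indicator[of E M borel "{ennreal a..}"] by simp
  also have "\<dots> = (\<integral>\<^sup>+x. f x * indicator {ennreal a..} (ennreal x) * indicator {0<..} x \<partial>lborel)"
    using a by (intro nn_integral_via_density law) auto
  also have "\<dots> = (\<integral>\<^sup>+x. f x * indicator {a..} x \<partial>lborel)"
    using a by (intro nn_integral_cong) (auto simp: indicator_def ennreal_le_iff2)
  also have "\<dots> \<le> (\<integral>\<^sup>+x. ennreal (x / (2 * a)) * f x * indicator {0<..} x \<partial>lborel)"
    by (rule nn_integral_antimono_tail_le[OF f decr a])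
  also have "\<dots> = (\<integral>\<^sup>+x. ennreal (1 / (2 * a)) * (f x * ennreal x * indicator {0<..} x) \<partial>lborel)"
  proof (intro nn_integral_cong)
    fix x :: real
    have "ennreal (x / (2 * a)) = ennreal (1 / (2 * a)) * ennreal x" if "0 < x"
      using that a by (simp flip: ennreal_mult)
    then show "ennreal (x / (2 * a)) * f x * indicator {0<..} x
        = ennreal (1 / (2 * a)) * (f x * ennreal x * indicator {0<..} x)"
      by (auto simp: mult_ac split: split_indicator)
  qed
  also have "\<dots> = ennreal (1 / (2 * a)) * (\<integral>\<^sup>+x. f x * ennreal x * indicator {0<..} x \<partial>lborel)"
    by (intro nn_integral_cmult) measurable
  also have "(\<integral>\<^sup>+x. f x * ennreal x * indicator {0<..} x \<partial>lborel) = (\<integral>\<^sup>+\<omega>. E \<omega> \<partial>M)"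
    by (intro nn_integral_via_density[symmetric] law) auto
  finally show ?thesis .
qed

lemma R_sup_decreasing_density_le:
  assumes x: "0 \<le> x"
  shows "R_sup M (decreasing_density_class M) (ennreal x) \<le> ennreal (x / 2)"
proof (cases "x = 0")
  case False
  with x have "0 < x" by simp
  have "emeasure M {\<omega> \<in> space M. 1 / ennreal x \<le> E \<omega>} \<le> ennreal (x / 2)"
    if "E \<in> decreasing_density_class M" for E
  proof -
    have E: "E \<in> borel_measurable M" "has_decreasing_density M E" "(\<integral>\<^sup>+\<omega>. E \<omega> \<partial>M) \<le> 1"
      using that by (auto simp: decreasing_density_class_def e_variable_def)
    have "1 / ennreal x = ennreal (1 / x)"
      using \<open>0 < x\<close> divide_ennreal[of 1 x] by simp
    then have "emeasure M {\<omega> \<in> space M. 1 / ennreal x \<le> E \<omega>}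
        \<le> ennreal (x / 2) * (\<integral>\<^sup>+\<omega>. E \<omega> \<partial>M)"
      using emeasure_tail_decreasing_density[OF E(1,2), of "1 / x"] \<open>0 < x\<close> by simp
    also have "\<dots> \<le> ennreal (x / 2)"
      using mult_left_mono[OF E(3), of "ennreal (x / 2)"] by simp
    finally show ?thesis .
  qed
  then show ?thesis
    using \<open>0 < x\<close> by (auto simp: R_sup_def intro!: SUP_least)
qed simp

section \<open>Stopping a product of independent e-variables at a predictable time\<close>

text \<open>
  Independence enters as independence of each factor from the past of the given filtration, so
  that a factor stays fresh even when the filtration is larger than the natural one.
\<close>
locale predictable_e_process = prob_space M for M :: "'a measure" +
  fixes T :: enat and F :: "nat \<Rightarrow> 'a measure" and E :: "nat \<Rightarrow> 'a \<Rightarrow> ennreal" and \<tau> :: "'a \<Rightarrow> nat"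
  assumes filtration: "filtration_upto M T F"
    and adapted: "adapted_upto T F E"
    and indep_past: "indep_of_past M T F E"
    and predictable: "predictable_time M T F \<tau>"
    and e_var: "\<And>t. t \<in> time_set T \<Longrightarrow> e_variable M (E t)"
begin

lemma time_set_pred_le: "t \<in> time_set T \<Longrightarrow> s \<le> t \<Longrightarrow> enat s \<le> T"
  by (auto simp: time_set_def intro: order_trans[of "enat s" "enat t"])

lemma subalg: "enat t \<le> T \<Longrightarrow> subalgebra M (F t)"
  using filtration by (simp add: filtration_upto_def)

lemma space_F: "enat t \<le> T \<Longrightarrow> space (F t) = space M"
  using subalg[of t] by (simp add: subalgebra_def)

lemma sets_F_mono: "s \<le> t \<Longrightarrow> enat t \<le> T \<Longrightarrow> A \<in> sets (F s) \<Longrightarrow> A \<in> sets (F t)"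
  using filtration unfolding filtration_upto_def subalgebra_def by blast

lemma measurable_F_imp: "enat t \<le> T \<Longrightarrow> X \<in> measurable (F t) N \<Longrightarrow> X \<in> measurable M N"
  using measurable_from_subalg[OF subalg] .

lemma tau_in: "\<omega> \<in> space M \<Longrightarrow> \<tau> \<omega> \<in> time_set T"
  using predictable by (simp add: predictable_time_def)

lemma M_proc_measurable_F:
  assumes "enat t \<le> T"
  shows "M_proc E t \<in> borel_measurable (F t)"
proof -
  have "E s \<in> borel_measurable (F t)" if "s \<in> {1..t}" for s
  proof (rule measurable_from_subalg)
    show "subalgebra (F t) (F s)"
      using that assms filtration by (auto simp: filtration_upto_def)
    have "s \<in> time_set T"
      using that assms by (auto simp: time_set_def intro: order_trans[of "enat s" "enat t"])
    then show "E s \<in> borel_measurable (F s)"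
      using adapted by (simp add: adapted_upto_def)
  qed
  then show ?thesis
    unfolding M_proc_def[abs_def] by (intro borel_measurable_prod_ennreal)
qed

lemma M_proc_measurable: "enat t \<le> T \<Longrightarrow> M_proc E t \<in> borel_measurable M"
  by (blast intro: measurable_F_imp M_proc_measurable_F)

lemma tau_eq_in_F: "t \<in> time_set T \<Longrightarrow> {\<omega> \<in> space M. \<tau> \<omega> = t} \<in> sets (F (t - 1))"
  using predictable by (simp add: predictable_time_def)

text \<open>Survival beyond time \<open>t\<close> is already decided at time \<open>t - 1\<close>.\<close>
lemma tau_greater_in_F:
  assumes t: "t \<in> time_set T"
  shows "{\<omega> \<in> space M. t < \<tau> \<omega>} \<in> sets (F (t - 1))"
proof -
  have le: "enat (t - 1) \<le> T"
    using t by (rule time_set_pred_le) simp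
  have "{\<omega> \<in> space M. \<tau> \<omega> = s} \<in> sets (F (t - 1))" if s: "s \<in> {1..t}" for s
  proof (rule sets_F_mono[OF _ le])
    show "s - 1 \<le> t - 1" using s by auto
    show "{\<omega> \<in> space M. \<tau> \<omega> = s} \<in> sets (F (s - 1))"
      using s t by (intro tau_eq_in_F) (auto simp: time_set_def intro: order_trans[of "enat s" "enat t"])
  qed
  then have "space (F (t - 1)) - (\<Union>s\<in>{1..t}. {\<omega> \<in> space M. \<tau> \<omega> = s}) \<in> sets (F (t - 1))"
    by (intro sets.compl_sets sets.finite_UN) auto
  also have "space (F (t - 1)) - (\<Union>s\<in>{1..t}. {\<omega> \<in> space M. \<tau> \<omega> = s}) = {\<omega> \<in> space M. t < \<tau> \<omega>}"
    using space_F[OF le] tau_in by (auto simp: time_set_def not_less)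
  finally show ?thesis .
qed

lemma at_tau_measurable:
  assumes "\<And>t. t \<in> time_set T \<Longrightarrow> g t \<in> borel_measurable M"
  shows "(\<lambda>\<omega>. indicator {\<omega> \<in> space M. \<tau> \<omega> = t} \<omega> * g t \<omega> :: ennreal) \<in> borel_measurable M"
proof (cases "t \<in> time_set T")
  case True
  have "{\<omega> \<in> space M. \<tau> \<omega> = t} \<in> sets M"
    using subalg[OF time_set_pred_le[OF True, of "t - 1"]] tau_eq_in_F[OF True]
    by (auto simp: subalgebra_def)
  with assms[OF True] show ?thesis by measurable
next
  case False
  then have "{\<omega> \<in> space M. \<tau> \<omega> = t} = {}"
    using tau_in by auto
  then show ?thesis by simp
qed

lemma indep_var_past:
  assumes t: "t \<in> time_set T" and X: "X \<in> borel_measurable (F (t - 1))"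
  shows "indep_var borel X borel (E t)"
proof -
  have le: "enat (t - 1) \<le> T"
    using t by (rule time_set_pred_le) simp
  have rv: "X \<in> borel_measurable M" "E t \<in> borel_measurable M"
    using measurable_F_imp[OF le X] e_var[OF t] by (auto simp: e_variable_def)
  have indep: "indep_set (sets (vimage_algebra (space M) (E t) borel)) (sets (F (t - 1)))"
    using indep_past t by (simp add: indep_of_past_def)
  have E: "sigma_sets (space M) {E t -` A \<inter> space M |A. A \<in> sets borel}
      = sets (vimage_algebra (space M) (E t) borel)"
    by (simp add: sets_vimage_algebra)
  have Xsub: "sigma_sets (space M) {X -` A \<inter> space M |A. A \<in> sets borel} \<subseteq> sets (F (t - 1))"
    using sets.sigma_sets_subset[of "{X -` A \<inter> space M |A. A \<in> sets borel}" "F (t - 1)"]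
      measurable_sets[OF X] unfolding space_F[OF le] by blast
  have "indep_set (sigma_sets (space M) {X -` A \<inter> space M |A. A \<in> sets borel})
      (sets (vimage_algebra (space M) (E t) borel))"
  proof (rule indep_setI)
    fix a b
    assume "a \<in> sigma_sets (space M) {X -` A \<inter> space M |A. A \<in> sets borel}"
      and "b \<in> sets (vimage_algebra (space M) (E t) borel)"
    with Xsub indep_setD[OF indep, of b a] show "prob (a \<inter> b) = prob a * prob b"
      by (auto simp: Int_commute mult.commute)
  qed (use Xsub indep_setD_ev1[OF indep] indep_setD_ev2[OF indep] in auto)
  with rv show ?thesis
    by (simp add: indep_var_eq E)
qed

lemma nn_integral_past_mult_le:
  assumes t: "t \<in> time_set T" and X: "X \<in> borel_measurable (F (t - 1))"
  shows "(\<integral>\<^sup>+\<omega>. X \<omega> * E t \<omega> \<partial>M) \<le> (\<integral>\<^sup>+\<omega>. X \<omega> \<partial>M)"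
proof -
  have E: "E t \<in> borel_measurable M" "(\<integral>\<^sup>+\<omega>. E t \<omega> \<partial>M) \<le> 1"
    using e_var[OF t] by (auto simp: e_variable_def)
  have "(\<integral>\<^sup>+\<omega>. X \<omega> * E t \<omega> \<partial>M) = (\<integral>\<^sup>+\<omega>. \<integral>\<^sup>+\<omega>'. X \<omega> * E t \<omega>' \<partial>M \<partial>M)"
    using nn_integral_indep_var[OF indep_var_past[OF t X], of "\<lambda>(x, y). x * y"] by simp
  also have "\<dots> = (\<integral>\<^sup>+\<omega>. X \<omega> * (\<integral>\<^sup>+\<omega>'. E t \<omega>' \<partial>M) \<partial>M)"
    using E(1) by (simp add: nn_integral_cmult)
  also have "\<dots> \<le> (\<integral>\<^sup>+\<omega>. X \<omega> \<partial>M)"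
    using mult_left_mono[OF E(2)] by (intro nn_integral_mono) simp
  finally show ?thesis .
qed

text \<open>
  Once the past \<open>X\<close> is frozen at a value \<open>x\<close>, the product reaches \<open>1 / \<gamma>\<close> only if the fresh
  factor reaches \<open>1 / (\<gamma> * x)\<close>.
\<close>
lemma emeasure_past_mult_ge:
  assumes t: "t \<in> time_set T" and X: "X \<in> borel_measurable (F (t - 1))"
    and E: "E t \<in> \<E>" and \<gamma>: "0 < \<gamma>"
  shows "emeasure M {\<omega> \<in> space M. ennreal (1 / \<gamma>) \<le> X \<omega> * E t \<omega>}
    \<le> (\<integral>\<^sup>+\<omega>. R_sup M \<E> (ennreal \<gamma> * X \<omega>) \<partial>M)"
proof -
  have [measurable]: "E t \<in> borel_measurable M" "X \<in> borel_measurable M"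
    using e_var[OF t] indep_var_past[OF t X] by (auto simp: e_variable_def indep_var_eq)
  have frozen: "emeasure M {\<omega> \<in> space M. ennreal (1 / \<gamma>) \<le> x * E t \<omega>}
      \<le> R_sup M \<E> (ennreal \<gamma> * x)" for x
  proof (cases "x = 0")
    case True
    then show ?thesis using \<gamma> by simp
  next
    case False
    have "1 / (ennreal \<gamma> * x) \<le> y" if y: "ennreal (1 / \<gamma>) \<le> x * y" for y
    proof (rule divide_le_posI_ennreal)
      show "0 < ennreal \<gamma> * x"
        using False \<gamma> by (simp add: zero_less_iff_neq_zero)
      have "1 = ennreal \<gamma> * ennreal (1 / \<gamma>)"
        using \<gamma> by (simp flip: ennreal_mult)
      also have "\<dots> \<le> ennreal \<gamma> * (x * y)"
        using y by (rule mult_left_mono) simp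
      finally show "1 \<le> ennreal \<gamma> * x * y"
        by (simp add: mult_ac)
    qed
    then have "emeasure M {\<omega> \<in> space M. ennreal (1 / \<gamma>) \<le> x * E t \<omega>}
        \<le> emeasure M {\<omega> \<in> space M. 1 / (ennreal \<gamma> * x) \<le> E t \<omega>}"
      by (intro emeasure_mono) auto
    also have "\<dots> \<le> (SUP X\<in>\<E>. emeasure M {\<omega> \<in> space M. 1 / (ennreal \<gamma> * x) \<le> X \<omega>})"
      using E by (rule SUP_upper)
    also have "\<dots> = R_sup M \<E> (ennreal \<gamma> * x)"
      using False \<gamma> by (simp add: R_sup_def)
    finally show ?thesis .
  qed
  have [measurable]: "{p. ennreal (1 / \<gamma>) \<le> fst p * snd p} \<in> sets (borel \<Otimes>\<^sub>M borel)"
  proof -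
    have "{p \<in> space (borel \<Otimes>\<^sub>M borel). ennreal (1 / \<gamma>) \<le> fst p * snd p} \<in> sets (borel \<Otimes>\<^sub>M borel)"
      by measurable
    then show ?thesis by (simp add: space_pair_measure)
  qed
  have "emeasure M {\<omega> \<in> space M. ennreal (1 / \<gamma>) \<le> X \<omega> * E t \<omega>}
      = (\<integral>\<^sup>+\<omega>. indicator {p. ennreal (1 / \<gamma>) \<le> fst p * snd p} (X \<omega>, E t \<omega>) \<partial>M)"
    using emeasure_eq_nn_integral_indicator[of "\<lambda>\<omega>. (X \<omega>, E t \<omega>)" M "borel \<Otimes>\<^sub>M borel"
        "{p. ennreal (1 / \<gamma>) \<le> fst p * snd p}"] by simp
  also have "\<dots> = (\<integral>\<^sup>+\<omega>. \<integral>\<^sup>+\<omega>'. indicator {p. ennreal (1 / \<gamma>) \<le> fst p * snd p} (X \<omega>, E t \<omega>') \<partial>M \<partial>M)"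
    by (rule nn_integral_indep_var[OF indep_var_past[OF t X]]) measurable
  also have "\<dots> = (\<integral>\<^sup>+\<omega>. emeasure M {\<omega>' \<in> space M. ennreal (1 / \<gamma>) \<le> X \<omega> * E t \<omega>'} \<partial>M)"
    using emeasure_eq_nn_integral_indicator[of "E t" M borel "{y. ennreal (1 / \<gamma>) \<le> X \<omega> * y}" for \<omega>]
    by (intro nn_integral_cong) (simp add: indicator_def)
  also have "\<dots> \<le> (\<integral>\<^sup>+\<omega>. R_sup M \<E> (ennreal \<gamma> * X \<omega>) \<partial>M)"
    by (intro nn_integral_mono frozen)
  finally show ?thesis .
qed

lemma M_proc_pred: "t \<in> time_set T \<Longrightarrow> M_proc E t \<omega> = M_proc E (t - 1) \<omega> * E t \<omega>"
  by (cases t) (auto simp: M_proc_def time_set_def)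

lemma M_proc_before_measurable: "t \<in> time_set T \<Longrightarrow> M_proc E (t - 1) \<in> borel_measurable M"
  by (intro M_proc_measurable time_set_pred_le) auto

lemma M_before_tau_measurable: "(\<lambda>\<omega>. M_proc E (\<tau> \<omega> - 1) \<omega>) \<in> borel_measurable M"
  by (intro measurable_at_random_index[where g = "\<lambda>t. M_proc E (t - 1)"] at_tau_measurable
      M_proc_before_measurable)

text \<open>
  The supermartingale stopped just before \<open>\<tau>\<close>: its mean at time \<open>n\<close> is the contribution of the
  paths already stopped plus that of the paths still running.  The decision whether
  to take the factor \<open>E (Suc n)\<close> is made at time \<open>n\<close>, so that the factor is independent of it.
\<close>
lemma stopped_mean_le_1:
  "(\<Sum>t\<le>n. \<integral>\<^sup>+\<omega>. indicator {\<omega> \<in> space M. \<tau> \<omega> = t} \<omega> * M_proc E (t - 1) \<omega> \<partial>M)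
    + (\<integral>\<^sup>+\<omega>. indicator {\<omega> \<in> space M. n < \<tau> \<omega>} \<omega> * M_proc E n \<omega> \<partial>M) \<le> 1"
proof (induction n)
  case 0
  have "{\<omega> \<in> space M. \<tau> \<omega> = 0} = {}" "{\<omega> \<in> space M. 0 < \<tau> \<omega>} = space M"
    using tau_in by (auto simp: time_set_def Suc_le_eq)
  then show ?case
    by (simp add: M_proc_def emeasure_space_1)
next
  case (Suc n)
  let ?stop = "\<lambda>t. \<integral>\<^sup>+\<omega>. indicator {\<omega> \<in> space M. \<tau> \<omega> = t} \<omega> * M_proc E (t - 1) \<omega> \<partial>M"
  let ?run = "\<lambda>n. \<integral>\<^sup>+\<omega>. indicator {\<omega> \<in> space M. n < \<tau> \<omega>} \<omega> * M_proc E n \<omega> \<partial>M"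
  have "?stop (Suc n) + ?run (Suc n) \<le> ?run n"
  proof (cases "Suc n \<in> time_set T")
    case True
    \<comment> \<open>\<open>X\<close> drops the paths that stop at \<open>Suc n\<close>; these are what \<open>?stop (Suc n)\<close> contributes.\<close>
    define X where "X \<omega> = indicator {\<omega> \<in> space M. Suc n < \<tau> \<omega>} \<omega> * M_proc E n \<omega>" for \<omega>
    have le: "enat n \<le> T"
      using True by (rule time_set_pred_le) simp
    have X: "X \<in> borel_measurable (F n)"
      unfolding X_def[abs_def] using tau_greater_in_F[OF True] M_proc_measurable_F[OF le] by simp
    have "?run (Suc n) = (\<integral>\<^sup>+\<omega>. X \<omega> * E (Suc n) \<omega> \<partial>M)"
      by (intro nn_integral_cong) (simp add: X_def M_proc_pred[OF True] mult_ac)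
    also have "\<dots> \<le> (\<integral>\<^sup>+\<omega>. X \<omega> \<partial>M)"
      using X by (intro nn_integral_past_mult_le[OF True]) simp
    finally have "?stop (Suc n) + ?run (Suc n) \<le> ?stop (Suc n) + (\<integral>\<^sup>+\<omega>. X \<omega> \<partial>M)"
      by (rule add_left_mono)
    also have "\<dots> = (\<integral>\<^sup>+\<omega>. indicator {\<omega> \<in> space M. \<tau> \<omega> = Suc n} \<omega> * M_proc E (Suc n - 1) \<omega> + X \<omega> \<partial>M)"
      by (intro nn_integral_add[symmetric] at_tau_measurable[where g = "\<lambda>t. M_proc E (t - 1)"]
          M_proc_before_measurable measurable_F_imp[OF le X])
    also have "\<dots> = ?run n"
      by (intro nn_integral_cong) (auto simp: X_def indicator_def)
    finally show ?thesis .
  next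
    case False
    have "\<tau> \<omega> \<noteq> Suc n" "\<not> Suc n < \<tau> \<omega>" if "\<omega> \<in> space M" for \<omega>
      using False tau_in[OF that] time_set_pred_le[of "\<tau> \<omega>" "Suc n"]
      by (auto simp: time_set_def)
    then have "{\<omega> \<in> space M. \<tau> \<omega> = Suc n} = {}" "{\<omega> \<in> space M. Suc n < \<tau> \<omega>} = {}"
      by auto
    then show ?thesis by simp
  qed
  then have "(\<Sum>t\<le>Suc n. ?stop t) + ?run (Suc n) \<le> (\<Sum>t\<le>n. ?stop t) + ?run n"
    by (simp add: add.assoc add_left_mono)
  then show ?case
    using Suc by (rule order_trans)
qed

lemma mean_before_tau_le_1: "(\<integral>\<^sup>+\<omega>. M_proc E (\<tau> \<omega> - 1) \<omega> \<partial>M) \<le> 1"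
proof -
  let ?stop = "\<lambda>t. \<integral>\<^sup>+\<omega>. indicator {\<omega> \<in> space M. \<tau> \<omega> = t} \<omega> * M_proc E (t - 1) \<omega> \<partial>M"
  have "(\<integral>\<^sup>+\<omega>. M_proc E (\<tau> \<omega> - 1) \<omega> \<partial>M) = (\<Sum>t. ?stop t)"
    by (intro nn_integral_at_random_index[where g = "\<lambda>t. M_proc E (t - 1)"] at_tau_measurable
        M_proc_before_measurable)
  also have "\<dots> \<le> 1"
  proof (rule suminf_le_const[OF summableI])
    fix n
    have "(\<Sum>t<n. ?stop t) \<le> (\<Sum>t\<le>n. ?stop t)"
      by (intro sum_mono2) auto
    also have "\<dots> \<le> 1"
      using order_trans[OF _ stopped_mean_le_1[of n]] by simp
    finally show "(\<Sum>t<n. ?stop t) \<le> 1" .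
  qed
  finally show ?thesis .
qed

lemma mean_scaled_before_tau_le:
  "(\<integral>\<^sup>+\<omega>. c * M_proc E (\<tau> \<omega> - 1) \<omega> \<partial>M) \<le> c"
  using mult_left_mono[OF mean_before_tau_le_1, of c] M_before_tau_measurable
  by (simp add: nn_integral_cmult)

text \<open>
  On \<open>\<tau> = t\<close> the last factor \<open>E t\<close> is fresh, so \<open>emeasure_past_mult_ge\<close> applies to the past
  \<open>M_proc E (t - 1)\<close> cut off outside that event; the cut-off costs nothing since \<open>R_sup\<close>
  vanishes at zero.
\<close>
lemma emeasure_M_tau_ge_le:
  assumes \<E>: "\<E> \<subseteq> borel_measurable M"
    and E: "\<And>t. t \<in> time_set T \<Longrightarrow> E t \<in> \<E>" and \<gamma>: "0 < \<gamma>"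
  shows "emeasure M {\<omega> \<in> space M. ennreal (1 / \<gamma>) \<le> M_proc E (\<tau> \<omega>) \<omega>}
    \<le> (\<integral>\<^sup>+\<omega>. R_sup M \<E> (ennreal \<gamma> * M_proc E (\<tau> \<omega> - 1) \<omega>) \<partial>M)"
proof -
  let ?I = "\<lambda>t. indicator {\<omega> \<in> space M. \<tau> \<omega> = t} :: 'a \<Rightarrow> ennreal"
  let ?hit = "\<lambda>t. indicator {\<omega> \<in> space M. ennreal (1 / \<gamma>) \<le> M_proc E t \<omega>} :: 'a \<Rightarrow> ennreal"
  let ?R = "\<lambda>t \<omega>. R_sup M \<E> (ennreal \<gamma> * M_proc E (t - 1) \<omega>)"
  have hit: "?hit t \<in> borel_measurable M" if "t \<in> time_set T" for t
  proof -
    have [measurable]: "M_proc E t \<in> borel_measurable M"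
      using that by (intro M_proc_measurable time_set_pred_le) auto
    show ?thesis by measurable
  qed
  have R: "?R t \<in> borel_measurable M" if "t \<in> time_set T" for t
    using M_proc_before_measurable[OF that] borel_measurable_R_sup[OF \<E>] by measurable
  have step: "(\<integral>\<^sup>+\<omega>. ?I t \<omega> * ?hit t \<omega> \<partial>M) \<le> (\<integral>\<^sup>+\<omega>. ?I t \<omega> * ?R t \<omega> \<partial>M)" for t
  proof (cases "t \<in> time_set T")
    case t: True
    define X where "X \<omega> = ?I t \<omega> * M_proc E (t - 1) \<omega>" for \<omega>
    have le: "enat (t - 1) \<le> T"
      using t by (rule time_set_pred_le) simp
    have X: "X \<in> borel_measurable (F (t - 1))"
      unfolding X_def[abs_def] using tau_eq_in_F[OF t] M_proc_measurable_F[OF le] by simp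
    have [measurable]: "X \<in> borel_measurable M" "E t \<in> borel_measurable M"
      using measurable_F_imp[OF le X] e_var[OF t] by (auto simp: e_variable_def)
    have "(\<integral>\<^sup>+\<omega>. ?I t \<omega> * ?hit t \<omega> \<partial>M)
        = (\<integral>\<^sup>+\<omega>. indicator {\<omega> \<in> space M. ennreal (1 / \<gamma>) \<le> X \<omega> * E t \<omega>} \<omega> \<partial>M)"
      using \<gamma> by (intro nn_integral_cong) (auto simp: X_def indicator_def M_proc_pred[OF t])
    also have "\<dots> = emeasure M {\<omega> \<in> space M. ennreal (1 / \<gamma>) \<le> X \<omega> * E t \<omega>}"
      by (rule nn_integral_indicator) measurable
    also have "\<dots> \<le> (\<integral>\<^sup>+\<omega>. R_sup M \<E> (ennreal \<gamma> * X \<omega>) \<partial>M)"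
      by (rule emeasure_past_mult_ge[OF t X E[OF t] \<gamma>])
    also have "\<dots> = (\<integral>\<^sup>+\<omega>. ?I t \<omega> * ?R t \<omega> \<partial>M)"
      by (intro nn_integral_cong) (auto simp: X_def indicator_def)
    finally show ?thesis .
  next
    case False
    then have "{\<omega> \<in> space M. \<tau> \<omega> = t} = {}"
      using tau_in by auto
    then show ?thesis by simp
  qed
  have ind: "indicator {\<omega> \<in> space M. ennreal (1 / \<gamma>) \<le> M_proc E (\<tau> \<omega>) \<omega>}
      = (\<lambda>\<omega>. ?hit (\<tau> \<omega>) \<omega>)"
    by (auto simp: indicator_def)
  have "(\<lambda>\<omega>. ?hit (\<tau> \<omega>) \<omega>) \<in> borel_measurable M"
    by (intro measurable_at_random_index[where g = ?hit] at_tau_measurable hit)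
  then have "{\<omega> \<in> space M. ennreal (1 / \<gamma>) \<le> M_proc E (\<tau> \<omega>) \<omega>} \<in> sets M"
    unfolding ind[symmetric] by (subst (asm) borel_measurable_indicator_iff) (simp add: Int_def conj_ac)
  then have "emeasure M {\<omega> \<in> space M. ennreal (1 / \<gamma>) \<le> M_proc E (\<tau> \<omega>) \<omega>}
      = (\<integral>\<^sup>+\<omega>. ?hit (\<tau> \<omega>) \<omega> \<partial>M)"
    by (simp add: ind[symmetric])
  also have "\<dots> = (\<Sum>t. \<integral>\<^sup>+\<omega>. ?I t \<omega> * ?hit t \<omega> \<partial>M)"
    by (intro nn_integral_at_random_index[where g = ?hit] at_tau_measurable hit)
  also have "\<dots> \<le> (\<Sum>t. \<integral>\<^sup>+\<omega>. ?I t \<omega> * ?R t \<omega> \<partial>M)"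
    by (intro suminf_le step summableI)
  also have "\<dots> = (\<integral>\<^sup>+\<omega>. ?R (\<tau> \<omega>) \<omega> \<partial>M)"
    by (intro nn_integral_at_random_index[where g = ?R, symmetric] at_tau_measurable R)
  finally show ?thesis .
qed

end

section \<open>The three bounds\<close>

text \<open>
  Below \<open>\<theta>\<close> this is the hypothesis; from \<open>1 / \<zeta>\<close> on the linear term alone is at least \<open>1\<close>.  In
  between, the excess of \<open>min z 1\<close> over \<open>\<zeta> * z\<close> is largest at \<open>z = 1\<close>, where it equals
  \<open>1 - \<zeta>\<close>, and this is at most \<open>1 / \<zeta> - 1\<close>.
\<close>
lemma (in prob_space) R_sup_le_linear_plus_window:
  fixes \<zeta> \<theta> :: real and z :: ennreal
  assumes e: "\<forall>X\<in>\<E>. e_variable M X" and \<zeta>: "0 < \<zeta>" "\<zeta> \<le> 1"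
    and small: "\<forall>x::real. 0 \<le> x \<longrightarrow> x < \<theta> \<longrightarrow> R_sup M \<E> (ennreal x) \<le> ennreal (\<zeta> * x)"
  shows "R_sup M \<E> z \<le> ennreal \<zeta> * z
    + ennreal (1 / \<zeta> - 1) * indicator {ennreal \<theta>..<ennreal (1 / \<zeta>)} z"
proof (cases z)
  case top
  then show ?thesis using \<zeta> by (simp add: ennreal_mult_top)
next
  case (real x)
  show ?thesis
  proof (cases "x < \<theta>")
    case True
    with small real have "R_sup M \<E> z \<le> ennreal \<zeta> * z"
      using \<zeta> by (auto simp: ennreal_mult)
    then show ?thesis by (rule order_trans) simp
  next
    case False
    have min: "R_sup M \<E> z \<le> ennreal (min x 1)"
      using R_sup_le[OF e, of z] R_sup_le_1[of \<E> z] real by (auto simp: min_def)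
    show ?thesis
    proof (cases "x < 1 / \<zeta>")
      case True
      have "min x 1 \<le> \<zeta> * x + (1 - \<zeta>)"
      proof (cases "x \<le> 1")
        case True
        then show ?thesis
          using mult_left_mono[of x 1 "1 - \<zeta>"] \<zeta> by (simp add: algebra_simps)
      next
        case False
        then show ?thesis
          using mult_left_mono[of 1 x \<zeta>] \<zeta> by simp
      qed
      also have "1 - \<zeta> = \<zeta> * (1 / \<zeta> - 1)"
        using \<zeta> by (simp add: field_simps)
      also have "\<dots> \<le> 1 / \<zeta> - 1"
        using \<zeta> by (intro mult_left_le_one_le) auto
      finally have "ennreal (min x 1) \<le> ennreal \<zeta> * z + ennreal (1 / \<zeta> - 1)"
        using \<zeta> real by (simp add: ennreal_leI flip: ennreal_mult ennreal_plus)
      moreover have "z \<in> {ennreal \<theta>..<ennreal (1 / \<zeta>)}"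
        using \<open>\<not> x < \<theta>\<close> True real \<zeta> by (auto intro: ennreal_leI ennreal_lessI)
      ultimately show ?thesis
        using min by simp
    next
      case False
      then have "1 \<le> \<zeta> * x"
        using \<zeta> by (simp add: field_simps)
      then have "ennreal (min x 1) \<le> ennreal \<zeta> * z"
        using \<zeta> real by (auto simp: min_le_iff_disj intro!: ennreal_leI simp flip: ennreal_mult)
      with min have "R_sup M \<E> z \<le> ennreal \<zeta> * z"
        by (rule order_trans)
      then show ?thesis by (rule order_trans) simp
    qed
  qed
qed

theorem theorem5:
  fixes M :: "'a measure" and T :: enat and F :: "nat \<Rightarrow> 'a measure"
    and E :: "nat \<Rightarrow> 'a \<Rightarrow> ennreal" and \<E> :: "('a \<Rightarrow> ennreal) set"
    and \<tau> :: "'a \<Rightarrow> nat" and \<gamma> :: real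
  assumes "prob_space M"
    and "filtration_upto M T F"
    and "adapted_upto T F E"
    and "prob_space.indep_vars M (\<lambda>_. borel) E (time_set T)"
    and "indep_of_past M T F E"
    and "predictable_time M T F \<tau>"
    and "\<forall>X\<in>\<E>. e_variable M X"
    and "\<forall>t\<in>time_set T. E t \<in> \<E>"
    and "0 < \<gamma>" and "\<gamma> \<le> 1"
  shows
    "((\<forall>x>0. R_sup M \<E> x \<le> x) \<and>
      emeasure M {\<omega> \<in> space M. M_proc E (\<tau> \<omega>) \<omega> \<ge> ennreal (1 / \<gamma>)}
        \<le> (\<integral>\<^sup>+\<omega>. R_sup M \<E> (ennreal \<gamma> * M_proc E (\<tau> \<omega> - 1) \<omega>) \<partial>M) \<and>
      (\<integral>\<^sup>+\<omega>. R_sup M \<E> (ennreal \<gamma> * M_proc E (\<tau> \<omega> - 1) \<omega>) \<partial>M) \<le> ennreal \<gamma>)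
     \<and>
     (\<forall>\<zeta> \<theta> \<delta> :: real. 0 < \<zeta> \<longrightarrow> \<zeta> \<le> 1 \<longrightarrow> 0 < \<theta> \<longrightarrow> \<theta> \<le> 1 \<longrightarrow>
        (\<forall>x::real. 0 \<le> x \<longrightarrow> x < \<theta> \<longrightarrow> R_sup M \<E> (ennreal x) \<le> ennreal (\<zeta> * x)) \<longrightarrow>
        \<delta> = measure M {\<omega> \<in> space M. ennreal \<theta> \<le> ennreal \<gamma> * M_proc E (\<tau> \<omega> - 1) \<omega> \<and>
               ennreal \<gamma> * M_proc E (\<tau> \<omega> - 1) \<omega> < ennreal (1 / \<zeta>)} \<longrightarrow>
        measure M {\<omega> \<in> space M. M_proc E (\<tau> \<omega>) \<omega> \<ge> ennreal (1 / \<gamma>)}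
          \<le> \<zeta> * \<gamma> + (1 / \<zeta> - 1) * \<delta>)
     \<and>
     (\<E> = decreasing_density_class M \<longrightarrow>
        measure M {\<omega> \<in> space M. M_proc E (\<tau> \<omega>) \<omega> \<ge> ennreal (1 / \<gamma>)} \<le> \<gamma> / 2)"
proof -
  have e: "\<forall>X\<in>\<E>. e_variable M X" and mem: "\<And>t. t \<in> time_set T \<Longrightarrow> E t \<in> \<E>" and \<gamma>: "0 < \<gamma>"
    using assms by auto
  interpret prob_space M by fact
  interpret predictable_e_process M T F E \<tau>
    using assms by unfold_locales auto
  let ?Z = "\<lambda>\<omega>. ennreal \<gamma> * M_proc E (\<tau> \<omega> - 1) \<omega>"
  let ?hit = "{\<omega> \<in> space M. M_proc E (\<tau> \<omega>) \<omega> \<ge> ennreal (1 / \<gamma>)}"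
  have [measurable]: "?Z \<in> borel_measurable M"
    using M_before_tau_measurable by measurable
  have hit: "emeasure M ?hit \<le> (\<integral>\<^sup>+\<omega>. R_sup M \<E> (?Z \<omega>) \<partial>M)"
    using e by (intro emeasure_M_tau_ge_le mem \<gamma>) (auto simp: e_variable_def)
  have mean: "(\<integral>\<^sup>+\<omega>. ?Z \<omega> \<partial>M) \<le> ennreal \<gamma>"
    by (rule mean_scaled_before_tau_le)
  have real_bound: "prob ?hit \<le> b" if "emeasure M ?hit \<le> ennreal b" "0 \<le> b" for b
    using that by (simp add: emeasure_eq_measure)

  have "(\<integral>\<^sup>+\<omega>. R_sup M \<E> (?Z \<omega>) \<partial>M) \<le> (\<integral>\<^sup>+\<omega>. ?Z \<omega> \<partial>M)"
    by (intro nn_integral_mono R_sup_le[OF e])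
  then have i: "(\<integral>\<^sup>+\<omega>. R_sup M \<E> (?Z \<omega>) \<partial>M) \<le> ennreal \<gamma>"
    using mean by (rule order_trans)

  have affine: "(\<integral>\<^sup>+\<omega>. a * X \<omega> + b * indicator W \<omega> \<partial>M) = a * (\<integral>\<^sup>+\<omega>. X \<omega> \<partial>M) + b * emeasure M W"
    if "X \<in> borel_measurable M" "W \<in> sets M" for X W and a b :: ennreal
    using that by (simp add: nn_integral_add nn_integral_cmult nn_integral_cmult_indicator)
  have ii: "prob ?hit \<le> \<zeta> * \<gamma> + (1 / \<zeta> - 1) * \<delta>"
    if \<zeta>: "0 < \<zeta>" "\<zeta> \<le> 1"
      and small: "\<forall>x::real. 0 \<le> x \<longrightarrow> x < \<theta> \<longrightarrow> R_sup M \<E> (ennreal x) \<le> ennreal (\<zeta> * x)"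
      and \<delta>: "\<delta> = prob {\<omega> \<in> space M. ennreal \<theta> \<le> ?Z \<omega> \<and> ?Z \<omega> < ennreal (1 / \<zeta>)}" for \<zeta> \<theta> \<delta> :: real
  proof (rule real_bound)
    let ?W = "{\<omega> \<in> space M. ennreal \<theta> \<le> ?Z \<omega> \<and> ?Z \<omega> < ennreal (1 / \<zeta>)}"
    have [measurable]: "?W \<in> sets M" by measurable
    have nonneg: "0 \<le> 1 / \<zeta> - 1" "0 \<le> \<delta>"
      using \<zeta> \<delta> by auto
    show "0 \<le> \<zeta> * \<gamma> + (1 / \<zeta> - 1) * \<delta>"
      using nonneg \<zeta> \<gamma> by simp
    have "emeasure M ?hit \<le> (\<integral>\<^sup>+\<omega>. ennreal \<zeta> * ?Z \<omega> + ennreal (1 / \<zeta> - 1) * indicator ?W \<omega> \<partial>M)"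
    proof (rule order_trans[OF hit], rule nn_integral_mono)
      fix \<omega> assume "\<omega> \<in> space M"
      then have "indicator {ennreal \<theta>..<ennreal (1 / \<zeta>)} (?Z \<omega>) = (indicator ?W \<omega> :: ennreal)"
        by (simp add: indicator_def)
      then show "R_sup M \<E> (?Z \<omega>) \<le> ennreal \<zeta> * ?Z \<omega> + ennreal (1 / \<zeta> - 1) * indicator ?W \<omega>"
        using R_sup_le_linear_plus_window[OF e \<zeta> small, of "?Z \<omega>"] by simp
    qed
    also have "\<dots> = ennreal \<zeta> * (\<integral>\<^sup>+\<omega>. ?Z \<omega> \<partial>M) + ennreal (1 / \<zeta> - 1) * emeasure M ?W"
      by (rule affine) measurable
    also have "\<dots> \<le> ennreal \<zeta> * ennreal \<gamma> + ennreal (1 / \<zeta> - 1) * ennreal \<delta>"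
      using mean by (intro add_mono mult_left_mono) (auto simp: \<delta> emeasure_eq_measure)
    also have "\<dots> = ennreal (\<zeta> * \<gamma> + (1 / \<zeta> - 1) * \<delta>)"
      using nonneg \<zeta> \<gamma> by (simp add: ennreal_mult ennreal_plus)
    finally show "emeasure M ?hit \<le> ennreal (\<zeta> * \<gamma> + (1 / \<zeta> - 1) * \<delta>)" .
  qed

  have iii: "prob ?hit \<le> \<gamma> / 2" if "\<E> = decreasing_density_class M"
  proof (rule real_bound)
    have half: "R_sup M \<E> z \<le> ennreal (1 / 2) * z" for z
    proof (cases z)
      case (real x)
      then have "ennreal (x / 2) = ennreal (1 / 2) * z"
        by (simp flip: ennreal_mult del: ennreal_half)
      with real show ?thesis
        using R_sup_decreasing_density_le[of x M] that by simp
    next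
      case top
      then show ?thesis by (simp add: ennreal_mult_top)
    qed
    have "emeasure M ?hit \<le> (\<integral>\<^sup>+\<omega>. ennreal (1 / 2) * ?Z \<omega> \<partial>M)"
      using hit by (rule order_trans) (intro nn_integral_mono half)
    also have "\<dots> = ennreal (1 / 2) * (\<integral>\<^sup>+\<omega>. ?Z \<omega> \<partial>M)"
      by (rule nn_integral_cmult) measurable
    also have "\<dots> \<le> ennreal (1 / 2) * ennreal \<gamma>"
      using mean by (rule mult_left_mono) simp
    also have "\<dots> = ennreal (\<gamma> / 2)"
      using \<gamma> by (simp flip: ennreal_mult del: ennreal_half)
    finally show "emeasure M ?hit \<le> ennreal (\<gamma> / 2)" .
  qed (use \<gamma> in simp)

  show ?thesis
    using R_sup_le[OF e] hit i ii iii by blast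
qed

end
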